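(* Let $b,c,\nu,\rho\in\mathbb{C}$ with $\operatorname{Re}(\nu)>-1$ and $\operatorname{Re}(\rho)>0$. For $z\in\mathbb{C}\setminus(-\infty,0]$, $$\frac{\partial}{\partial z}\Big[z^{-\nu+1}\frac{\partial}{\partial z}\big(z^\nu G_\nu^{(b,c-1)}(z;\rho)\big)\Big]=(c-1)\,G_{\nu-1}^{(b,c)}(z;\rho).$$
   Context: For $\rho\in\mathbb{C}$ with $\operatorname{Re}(\rho)>0$ and $x\in\mathbb{C}$ put $\Gamma_\rho(x)=\int_0^\infty t^{x-1}e^{-t-\rho/t}\,dt$. The generalized Pochhammer symbol is $(\lambda;\rho)_\nu:=\Gamma_\rho(\lambda+\nu)/\Gamma(\lambda)$ for $\lambda,\nu\in\mathbb{C}$, where $1/\Gamma$ is read as an entire function (zero at $0,-1,-2,\dots$). The unified four parameter Bessel function is $$G_\nu^{(b,c)}(z;\rho):=\sum_{k=0}^\infty \frac{(-b)^k (c;\rho)_{2k+\nu}}{\Gamma(\nu+k+1)\,\Gamma(\nu+2k+1)}\,\frac{(z/2)^{2k+\nu}}{k!}.$$ $G_{\nu-1}^{(b,c)}$ is given by the same series with $\nu-1$ in place of $\nu$. Complex powers are principal. *)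

theory Defs
  imports "HOL-Analysis.Analysis"
begin

definition Gamma_ext :: "complex \<Rightarrow> complex \<Rightarrow> complex" where
  "Gamma_ext \<rho> x =
     (LINT t:{0<..}|lborel. of_real t powr (x - 1) * exp (- of_real t - \<rho> / of_real t))"

(* rGamma is the entire function 1/Gamma, vanishing at 0, -1, -2, ... *)
definition gen_pochhammer :: "complex \<Rightarrow> complex \<Rightarrow> complex \<Rightarrow> complex" where
  "gen_pochhammer a \<rho> \<nu> = Gamma_ext \<rho> (a + \<nu>) * rGamma a"

(* Argument order: gen_bessel b c nu rho z stands for G_nu^(b,c)(z; rho). *)
definition gen_bessel ::
  "complex \<Rightarrow> complex \<Rightarrow> complex \<Rightarrow> complex \<Rightarrow> complex \<Rightarrow> complex" where
  "gen_bessel b c \<nu> \<rho> z =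
     (\<Sum>k. (- b) ^ k * gen_pochhammer c \<rho> (2 * of_nat k + \<nu>)
            * rGamma (\<nu> + of_nat k + 1) * rGamma (\<nu> + 2 * of_nat k + 1)
            * ((z / 2) powr (2 * of_nat k + \<nu>) / fact k))"

end

theory Submission
  imports Defs "HOL-Real_Asymp.Real_Asymp"
begin

text \<open>
  After the factor \<open>z powr \<nu>\<close> is taken out, \<open>G\<^sub>\<nu>\<close> is an entire power series in \<open>z\<^sup>2\<close>. On a
  series \<open>z powr s * (\<Sum>k. a k * (z\<^sup>2) ^ k)\<close> differentiation lowers \<open>s\<close> by one and multiplies
  the \<open>k\<close>-th coefficient by \<open>s + 2 * k\<close> (lemma \<open>DERIV_powr_times_power_series\<close>). The operator
  in the theorem does this twice, first with \<open>s = 2 * \<nu>\<close> and, once the factor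
  \<open>z powr (1 - \<nu>)\<close> has brought the exponent back to \<open>\<nu>\<close>, with \<open>s = \<nu>\<close>. Altogether the
  \<open>k\<close>-th coefficient gets the factor \<open>2 * (\<nu> + k) * (\<nu> + 2 * k)\<close>, and the functional equation
  of \<open>1 / \<Gamma>\<close> turns this into the shift from \<open>(\<nu>, c - 1)\<close> to \<open>(\<nu> - 1, c)\<close> (lemma
  \<open>bessel_coeff_shift\<close>); the extended Gamma function is not affected, as its argument
  \<open>c + \<nu> - 1 + 2 * k\<close> is the same on both sides.

  The analytic input is that the series converges everywhere (lemma \<open>bessel_coeff_entire\<close>).
  For \<open>Re \<rho> \<ge> 0\<close> the factor \<open>exp (- \<rho> / t)\<close> has modulus at most one, so that the extended
  Gamma function is dominated by the classical one on the real axis. The series is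
  then dominated by one that passes the ratio test.
\<close>

section \<open>Domination of the extended Gamma function\<close>

lemma set_integral_Gamma_real:
  fixes \<alpha> :: real
  assumes "\<alpha> > 0"
  shows "integrable lborel (\<lambda>t. indicator {0<..} t * (t powr (\<alpha> - 1) * exp (- t)))"
    and "(\<integral>t. indicator {0<..} t * (t powr (\<alpha> - 1) * exp (- t)) \<partial>lborel) = Gamma \<alpha>"
proof -
  let ?f = "\<lambda>t::real. indicator {0<..} t * (t powr (\<alpha> - 1) * exp (- t))"
  have "((\<lambda>t. t powr (\<alpha> - 1) / exp t) has_integral Gamma \<alpha>) {0..}"
    by (rule Gamma_integral_real[OF assms])
  then have "((\<lambda>t. if t \<in> {0..} then t powr (\<alpha> - 1) / exp t else 0) has_integral Gamma \<alpha>) UNIV"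
    by (simp only: has_integral_restrict_UNIV)
  moreover have "(\<lambda>t. if t \<in> {0..} then t powr (\<alpha> - 1) / exp t else 0) = ?f"
    by (auto simp: fun_eq_iff indicator_def exp_minus field_simps)
  ultimately have hi: "(?f has_integral Gamma \<alpha>) UNIV" by simp
  have "(\<integral>\<^sup>+t. ennreal (?f t) \<partial>lborel) = ennreal (Gamma \<alpha>)"
    by (rule nn_integral_has_integral_lborel[OF _ _ hi]) auto
  then have "has_bochner_integral lborel ?f (Gamma \<alpha>)"
    using Gamma_real_pos[OF assms]
    by (intro has_bochner_integral_nn_integral) auto
  then show "integrable lborel ?f" "integral\<^sup>L lborel ?f = Gamma \<alpha>"
    by (auto simp: has_bochner_integral_iff)
qed

lemma norm_Gamma_ext_le:
  assumes "Re x > 0" "Re \<rho> \<ge> 0"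
  shows "norm (Gamma_ext \<rho> x) \<le> Gamma (Re x)"
proof -
  let ?g = "\<lambda>t::real. indicat_real {0<..} t *\<^sub>R
              (of_real t powr (x - 1) * exp (- of_real t - \<rho> / of_real t))"
  let ?f = "\<lambda>t::real. indicator {0<..} t * (t powr (Re x - 1) * exp (- t))"
  have le: "norm (?g t) \<le> ?f t" for t
  proof (cases "t > 0")
    case True
    have "Re (\<rho> / of_real t) \<ge> 0"
      using True assms by simp
    then have "norm (exp (- of_real t - \<rho> / of_real t)) \<le> exp (- t)"
      by simp
    then show ?thesis
      using True by (simp add: norm_mult norm_powr_real_powr mult_left_mono)
  qed simp
  have "norm (integral\<^sup>L lborel ?g) \<le> integral\<^sup>L lborel ?f"
  proof (cases "integrable lborel ?g")
    case True
    from this set_integral_Gamma_real(1)[OF assms(1)] le show ?thesis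
      by (rule Bochner_Integration.integral_norm_bound_integral)
  next
    case False
    \<comment> \<open>The integral of a function that is not integrable is \<open>0\<close>.\<close>
    then show ?thesis
      using set_integral_Gamma_real(2)[OF assms(1)] Gamma_real_pos[OF assms(1)]
      by (simp add: not_integrable_integral_eq)
  qed
  then show ?thesis
    using set_integral_Gamma_real(2)[OF assms(1)]
    by (simp add: Gamma_ext_def set_lebesgue_integral_def)
qed

section \<open>The Bessel function as a power series\<close>

text \<open>
  The coefficients of \<open>z powr (- \<nu>) * G\<^sub>\<nu>(z)\<close> as a power series in \<open>z\<^sup>2\<close>; the last denominator
  collects what the halves in \<open>(z / 2) powr (2 * k + \<nu>)\<close> contribute.
\<close>

definition bessel_coeff :: "complex \<Rightarrow> complex \<Rightarrow> complex \<Rightarrow> complex \<Rightarrow> nat \<Rightarrow> complex" where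
  "bessel_coeff b c \<nu> \<rho> k =
     (- b) ^ k * gen_pochhammer c \<rho> (2 * of_nat k + \<nu>)
       * rGamma (\<nu> + of_nat k + 1) * rGamma (\<nu> + 2 * of_nat k + 1)
       / (fact k * (2 powr \<nu> * 4 ^ k))"

lemma norm_rGamma_plus1_le:
  fixes x :: complex
  assumes "Re x > 0"
  shows "norm (rGamma (x + 1)) \<le> norm (rGamma x) / Re x"
proof -
  have "Re x * norm (rGamma (x + 1)) \<le> norm x * norm (rGamma (x + 1))"
    by (intro mult_right_mono complex_Re_le_cmod) auto
  also have "\<dots> = norm (rGamma x)"
    by (metis norm_mult rGamma_plus1)
  finally show ?thesis
    using assms by (simp add: field_simps)
qed

lemma Gamma_real_plus2:
  assumes "x > 0"
  shows "Gamma (x + 2 :: real) = x * (x + 1) * Gamma x"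
  using Gamma_plus1[of x] Gamma_plus1[of "x + 1"] assms
  by (auto simp: add.assoc nonpos_Ints_def)

text \<open>
  Ratio test: for large \<open>k\<close>, \<open>\<Gamma>(\<alpha> + 2k) / \<Gamma>(\<nu> + 2k + 1)\<close> changes by a bounded factor from one
  \<open>k\<close> to the next, while the denominators \<open>k!\<close> and \<open>\<Gamma>(\<nu> + k + 1)\<close> contribute factors that
  tend to zero.
\<close>

lemma summable_Gamma_ratio:
  fixes \<alpha> r :: real and \<nu> :: complex
  assumes "r \<ge> 0"
  shows "summable (\<lambda>k. Gamma (\<alpha> + 2 * real k)
           * (norm (rGamma (\<nu> + of_nat k + 1)) * norm (rGamma (\<nu> + 2 * of_nat k + 1)))
           * r ^ k / fact k)"
    (is "summable ?f")
proof -
  define n where "n = Re \<nu>"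
  \<comment> \<open>An upper bound for the quotient of consecutive terms: degree two over degree four in \<open>k\<close>.\<close>
  define q where "q = (\<lambda>k. (\<alpha> + 2 * real k) * (\<alpha> + 2 * real k + 1) * r
     / ((real k + 1) * (n + real k + 1) * ((n + 2 * real k + 1) * (n + 2 * real k + 2))))"
  have "eventually (\<lambda>k. q k \<le> 1 / 2) sequentially"
  proof -
    have "q \<longlonglongrightarrow> 0" unfolding q_def by real_asymp
    then have "eventually (\<lambda>k. q k < 1 / 2) sequentially"
      by (rule order_tendstoD) simp
    then show ?thesis by eventually_elim simp
  qed
  moreover have "eventually (\<lambda>k. \<alpha> + 2 * real k > 0) sequentially" by real_asymp
  moreover have "eventually (\<lambda>k. n + real k + 1 > 0) sequentially" by real_asymp
  moreover have "eventually (\<lambda>k. n + 2 * real k + 1 > 0) sequentially" by real_asymp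
  ultimately have "eventually (\<lambda>k. norm (?f (Suc k)) \<le> 1 / 2 * norm (?f k)) sequentially"
  proof eventually_elim
    case (elim k)
    let ?x = "\<alpha> + 2 * real k" and ?y = "\<nu> + of_nat k + 1" and ?w = "\<nu> + 2 * of_nat k + 1"
    have G: "Gamma (\<alpha> + 2 * real (Suc k)) = ?x * (?x + 1) * Gamma ?x"
      using Gamma_real_plus2[OF elim(2)] by (simp add: algebra_simps)
    have y: "norm (rGamma (\<nu> + of_nat (Suc k) + 1)) \<le> norm (rGamma ?y) / (n + real k + 1)"
      using norm_rGamma_plus1_le[of ?y] elim(3) by (simp add: n_def add_ac)
    have "norm (rGamma (\<nu> + 2 * of_nat (Suc k) + 1)) \<le> norm (rGamma (?w + 1)) / (n + 2 * real k + 2)"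
      using norm_rGamma_plus1_le[of "?w + 1"] elim(4) by (simp add: n_def algebra_simps)
    also have "\<dots> \<le> norm (rGamma ?w) / (n + 2 * real k + 1) / (n + 2 * real k + 2)"
      using norm_rGamma_plus1_le[of ?w] elim(4) by (intro divide_right_mono) (auto simp: n_def)
    finally have w: "norm (rGamma (\<nu> + 2 * of_nat (Suc k) + 1))
        \<le> norm (rGamma ?w) / (n + 2 * real k + 1) / (n + 2 * real k + 2)" .
    have G0: "Gamma ?x > 0" using elim(2) by (rule Gamma_real_pos)
    have f0: "?f k \<ge> 0" using G0 assms by simp
    have "?f (Suc k) \<le> ?x * (?x + 1) * Gamma ?x
        * (norm (rGamma ?y) / (n + real k + 1)
           * (norm (rGamma ?w) / (n + 2 * real k + 1) / (n + 2 * real k + 2)))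
        * r ^ Suc k / fact (Suc k)"
      unfolding G using elim G0 assms
      by (intro divide_right_mono mult_right_mono mult_left_mono mult_mono y w) auto
    also have "\<dots> = q k * ?f k"
      by (simp add: q_def add_ac mult_ac)
    also have "\<dots> \<le> 1 / 2 * ?f k"
      using elim(1) f0 by (rule mult_right_mono)
    finally have "?f (Suc k) \<le> 1 / 2 * ?f k" .
    moreover have "?f (Suc k) \<ge> 0"
      unfolding G using G0 assms elim(2) by simp
    ultimately show ?case
      using f0 by (simp only: real_norm_def abs_of_nonneg)
  qed
  then obtain N where "\<And>k. k \<ge> N \<Longrightarrow> norm (?f (Suc k)) \<le> 1 / 2 * norm (?f k)"
    by (auto simp: eventually_sequentially)
  then show ?thesis
    by (intro summable_ratio_test[of "1 / 2" N]) auto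
qed

text \<open>
  Finitely many terms with \<open>Re (c + \<nu>) + 2 * k \<le> 0\<close> are not covered by the Gamma bound,
  hence the comparison only holds eventually.
\<close>

lemma bessel_coeff_entire:
  assumes "Re \<rho> \<ge> 0"
  shows "summable (\<lambda>k. bessel_coeff b c \<nu> \<rho> k * u ^ k)"
proof -
  define \<alpha> where "\<alpha> = Re (c + \<nu>)"
  define r where "r = norm (b * u / 4)"
  define C where "C = norm (rGamma c / 2 powr \<nu>)"
  let ?f = "\<lambda>k. Gamma (\<alpha> + 2 * real k)
           * (norm (rGamma (\<nu> + of_nat k + 1)) * norm (rGamma (\<nu> + 2 * of_nat k + 1)))
           * r ^ k / fact k"
  have "eventually (\<lambda>k. \<alpha> + 2 * real k > 0) sequentially" by real_asymp
  then have "eventually (\<lambda>k. norm (bessel_coeff b c \<nu> \<rho> k * u ^ k) \<le> C * ?f k) sequentially"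
  proof eventually_elim
    case (elim k)
    have "norm (Gamma_ext \<rho> (c + (2 * of_nat k + \<nu>))) \<le> Gamma (\<alpha> + 2 * real k)"
      using norm_Gamma_ext_le[of "c + (2 * of_nat k + \<nu>)" \<rho>] assms elim
      by (simp add: \<alpha>_def add_ac)
    then have "norm (Gamma_ext \<rho> (c + (2 * of_nat k + \<nu>)))
        * (C * (norm (rGamma (\<nu> + of_nat k + 1)) * norm (rGamma (\<nu> + 2 * of_nat k + 1))
             * r ^ k / fact k))
      \<le> Gamma (\<alpha> + 2 * real k)
        * (C * (norm (rGamma (\<nu> + of_nat k + 1)) * norm (rGamma (\<nu> + 2 * of_nat k + 1))
             * r ^ k / fact k))"
      by (rule mult_right_mono) (auto simp: C_def r_def)
    then show ?case
      by (simp add: bessel_coeff_def gen_pochhammer_def C_def r_def norm_mult norm_divide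
            norm_power power_mult_distrib power_divide mult_ac)
  qed
  moreover have "summable (\<lambda>k. C * ?f k)"
    by (intro summable_mult summable_Gamma_ratio) (simp add: r_def)
  ultimately show ?thesis
    by (rule summable_comparison_test_ev)
qed

lemma gen_bessel_eq_power_series:
  assumes "Re \<rho> \<ge> 0" "z \<noteq> 0"
  shows "gen_bessel b c \<nu> \<rho> z = z powr \<nu> * (\<Sum>k. bessel_coeff b c \<nu> \<rho> k * (z\<^sup>2) ^ k)"
proof -
  have half: "(z / 2) powr (2 * of_nat k + \<nu>) = z powr \<nu> * (z\<^sup>2) ^ k / (2 powr \<nu> * 4 ^ k)" for k
  proof -
    have "(z / 2) powr (2 * of_nat k + \<nu>) = (z / 2) powr of_nat (2 * k) * (z / 2) powr \<nu>"
      by (simp add: powr_add)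
    also have "(z / 2) powr of_nat (2 * k) = (z / 2) ^ (2 * k)"
      using assms(2) by (subst powr_nat) auto
    also have "\<dots> = (z\<^sup>2) ^ k / 4 ^ k"
      by (simp add: power_mult power_divide)
    also have "(z / 2) powr \<nu> = z powr \<nu> / 2 powr \<nu>"
      using powr_times_real_left[of 2 "z / 2" \<nu>] by simp
    finally show ?thesis by (simp add: mult_ac)
  qed
  have "gen_bessel b c \<nu> \<rho> z = (\<Sum>k. z powr \<nu> * (bessel_coeff b c \<nu> \<rho> k * (z\<^sup>2) ^ k))"
    unfolding gen_bessel_def half bessel_coeff_def by (intro suminf_cong) (simp add: mult_ac)
  also have "\<dots> = z powr \<nu> * (\<Sum>k. bessel_coeff b c \<nu> \<rho> k * (z\<^sup>2) ^ k)"
    by (rule suminf_mult[OF bessel_coeff_entire[OF assms(1)]])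
  finally show ?thesis .
qed

section \<open>Differentiation and the shift of parameters\<close>

lemma power_series_times_index:
  fixes a :: "nat \<Rightarrow> complex"
  assumes "\<And>u. summable (\<lambda>k. a k * u ^ k)"
  shows "(\<lambda>k. of_nat k * a k * u ^ k) sums (u * (\<Sum>k. diffs a k * u ^ k))"
proof -
  have "summable (\<lambda>k. diffs a k * u ^ k)"
    by (rule termdiff_converges_all[OF assms])
  from sums_mult[OF diffs_equiv[OF this], of u]
  have "(\<lambda>k. u * (of_nat k * a k * u ^ (k - Suc 0))) sums (u * (\<Sum>k. diffs a k * u ^ k))" .
  moreover have "u * (of_nat k * a k * u ^ (k - Suc 0)) = of_nat k * a k * u ^ k" for k
    by (cases k) auto
  ultimately show ?thesis by simp
qed

lemma summable_power_series_affine: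
  fixes a :: "nat \<Rightarrow> complex"
  assumes "\<And>u. summable (\<lambda>k. a k * u ^ k)"
  shows "summable (\<lambda>k. (s + 2 * of_nat k) * a k * u ^ k)"
proof -
  have "summable (\<lambda>k. s * (a k * u ^ k) + 2 * (of_nat k * a k * u ^ k))"
    using assms power_series_times_index[OF assms]
    by (intro summable_add summable_mult) (auto simp: sums_iff)
  then show ?thesis by (simp add: algebra_simps)
qed

text \<open>
  The terms \<open>a k * w powr (s + 2 * k)\<close> may be differentiated one by one, as the series has
  infinite radius of convergence.
\<close>

lemma DERIV_powr_times_power_series:
  fixes a :: "nat \<Rightarrow> complex"
  assumes entire: "\<And>u. summable (\<lambda>k. a k * u ^ k)" and z: "z \<notin> \<real>\<^sub>\<le>\<^sub>0"
  shows "((\<lambda>w. w powr s * (\<Sum>k. a k * (w\<^sup>2) ^ k)) has_field_derivative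
           z powr (s - 1) * (\<Sum>k. (s + 2 * of_nat k) * a k * (z\<^sup>2) ^ k)) (at z)"
proof -
  let ?F = "\<lambda>u. \<Sum>k. a k * u ^ k" and ?D = "\<lambda>u. \<Sum>k. diffs a k * u ^ k"
  have z0: "z \<noteq> 0" using z by auto
  have F: "(?F has_field_derivative ?D u) (at u)" for u
    by (rule termdiffs_strong_converges_everywhere[OF entire])
  have sq: "((\<lambda>w. w\<^sup>2) has_field_derivative 2 * z) (at z)"
    by (auto intro!: derivative_eq_intros)
  have comp: "((\<lambda>w. ?F (w\<^sup>2)) has_field_derivative ?D (z\<^sup>2) * (2 * z)) (at z)"
    by (rule DERIV_chain2[OF F sq])
  have pw: "((\<lambda>w. w powr s) has_field_derivative s * z powr (s - 1)) (at z)"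
    using z by (rule has_field_derivative_powr)
  have z1: "z powr s = z powr (s - 1) * z"
    using z0 by (simp add: powr_diff)
  have "(\<lambda>k. s * (a k * (z\<^sup>2) ^ k) + 2 * (of_nat k * a k * (z\<^sup>2) ^ k))
          sums (s * ?F (z\<^sup>2) + 2 * (z\<^sup>2 * ?D (z\<^sup>2)))"
    by (intro sums_add sums_mult power_series_times_index summable_sums entire)
  then have "(\<Sum>k. (s + 2 * of_nat k) * a k * (z\<^sup>2) ^ k) = s * ?F (z\<^sup>2) + 2 * (z\<^sup>2 * ?D (z\<^sup>2))"
    by (simp add: sums_iff algebra_simps)
  then show ?thesis
    using DERIV_mult[OF pw comp] z1
    by (simp add: algebra_simps power2_eq_square)
qed

text \<open>
  Each linear factor on the left is absorbed by one reciprocal Gamma function: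
  \<open>\<nu> + k\<close> and \<open>\<nu> + 2 * k\<close> lower \<open>\<nu>\<close> by one in the two denominators, and \<open>1 / \<Gamma>(c - 1)\<close> releases
  the factor \<open>c - 1\<close> on the right. The remaining \<open>2\<close> accounts for \<open>2 powr \<nu>\<close> becoming
  \<open>2 powr (\<nu> - 1)\<close>. The functional equation of \<open>1 / \<Gamma>\<close> holds at the poles of \<open>\<Gamma>\<close> as well, so
  the identity covers degenerate \<open>c\<close> and \<open>\<nu>\<close>.
\<close>

lemma bessel_coeff_shift:
  "(\<nu> + 2 * of_nat k) * ((2 * \<nu> + 2 * of_nat k) * bessel_coeff b (c - 1) \<nu> \<rho> k)
     = (c - 1) * bessel_coeff b c (\<nu> - 1) \<rho> k"
proof -
  have half: "(2::complex) powr (\<nu> - 1) = 2 powr \<nu> / 2"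
    by (simp add: powr_diff)
  have g1: "rGamma (c - 1) = (c - 1) * rGamma c"
    using rGamma_plus1[of "c - 1"] by simp
  have g2: "rGamma (\<nu> - 1 + of_nat k + 1) = (\<nu> + of_nat k) * rGamma (\<nu> + of_nat k + 1)"
    using rGamma_plus1[of "\<nu> + of_nat k"] by simp
  have g3: "rGamma (\<nu> - 1 + 2 * of_nat k + 1) = (\<nu> + 2 * of_nat k) * rGamma (\<nu> + 2 * of_nat k + 1)"
    using rGamma_plus1[of "\<nu> + 2 * of_nat k"] by simp
  have arg: "c + (2 * of_nat k + (\<nu> - 1)) = c - 1 + (2 * of_nat k + \<nu>)"
    by simp
  show ?thesis
    unfolding bessel_coeff_def gen_pochhammer_def half g1 g2 g3 arg
    by (simp add: field_simps)
qed

theorem theorem3p1: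
  fixes b c \<nu> \<rho> z :: complex
  assumes "Re \<nu> > -1" and "Re \<rho> > 0" and "z \<notin> \<real>\<^sub>\<le>\<^sub>0"
  shows "(\<lambda>w. w powr \<nu> * gen_bessel b (c - 1) \<nu> \<rho> w) field_differentiable (at z)
    \<and> ((\<lambda>w. w powr (- \<nu> + 1) * deriv (\<lambda>u. u powr \<nu> * gen_bessel b (c - 1) \<nu> \<rho> u) w)
         has_field_derivative (c - 1) * gen_bessel b c (\<nu> - 1) \<rho> z) (at z)"
proof -
  let ?H = "\<lambda>w. w powr \<nu> * gen_bessel b (c - 1) \<nu> \<rho> w"
  define a where "a = bessel_coeff b (c - 1) \<nu> \<rho>"
  define a' where "a' = (\<lambda>k. (2 * \<nu> + 2 * of_nat k) * a k)"
  have \<rho>: "Re \<rho> \<ge> 0" using assms(2) by simp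
  have a: "summable (\<lambda>k. a k * u ^ k)" for u
    unfolding a_def by (rule bessel_coeff_entire[OF \<rho>])
  have a': "summable (\<lambda>k. a' k * u ^ k)" for u
    unfolding a'_def by (rule summable_power_series_affine[OF a])
  have op: "open (- \<real>\<^sub>\<le>\<^sub>0 :: complex set)"
    by (simp add: open_Compl)
  have H: "?H w = w powr (2 * \<nu>) * (\<Sum>k. a k * (w\<^sup>2) ^ k)" if "w \<in> - \<real>\<^sub>\<le>\<^sub>0" for w
  proof -
    have "w \<noteq> 0" using that by auto
    moreover have "w powr (2 * \<nu>) = w powr \<nu> * w powr \<nu>"
      by (simp flip: powr_add)
    ultimately show ?thesis
      by (simp add: gen_bessel_eq_power_series[OF \<rho>] a_def)
  qed
  \<comment> \<open>The inner derivative is computed on the whole slit plane, as the outer one needs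
      it in a neighbourhood of \<open>z\<close>.\<close>
  have dH: "(?H has_field_derivative w powr (2 * \<nu> - 1) * (\<Sum>k. a' k * (w\<^sup>2) ^ k)) (at w)"
    if w: "w \<in> - \<real>\<^sub>\<le>\<^sub>0" for w
  proof -
    have "((\<lambda>w. w powr (2 * \<nu>) * (\<Sum>k. a k * (w\<^sup>2) ^ k)) has_field_derivative
            w powr (2 * \<nu> - 1) * (\<Sum>k. a' k * (w\<^sup>2) ^ k)) (at w)"
      unfolding a'_def using w by (intro DERIV_powr_times_power_series a) auto
    then show ?thesis
      by (rule has_field_derivative_transform_within_open[OF _ op w]) (simp add: H)
  qed
  have middle: "w powr (- \<nu> + 1) * deriv ?H w = w powr \<nu> * (\<Sum>k. a' k * (w\<^sup>2) ^ k)"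
    if w: "w \<in> - \<real>\<^sub>\<le>\<^sub>0" for w
  proof -
    have "w \<noteq> 0" using w by auto
    then have "w powr (- \<nu> + 1) * w powr (2 * \<nu> - 1) = w powr \<nu>"
      by (simp flip: powr_add)
    then show ?thesis
      unfolding DERIV_imp_deriv[OF dH[OF w]] by (simp flip: mult.assoc)
  qed
  have z: "z \<in> - \<real>\<^sub>\<le>\<^sub>0" using assms(3) by simp
  have z0: "z \<noteq> 0" using z by auto
  have "((\<lambda>w. w powr \<nu> * (\<Sum>k. a' k * (w\<^sup>2) ^ k)) has_field_derivative
          z powr (\<nu> - 1) * (\<Sum>k. (\<nu> + 2 * of_nat k) * a' k * (z\<^sup>2) ^ k)) (at z)"
    by (rule DERIV_powr_times_power_series[OF a' assms(3)])
  also have "(\<lambda>k. (\<nu> + 2 * of_nat k) * a' k * (z\<^sup>2) ^ k)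
      = (\<lambda>k. (c - 1) * (bessel_coeff b c (\<nu> - 1) \<rho> k * (z\<^sup>2) ^ k))"
    unfolding a'_def a_def by (simp only: bessel_coeff_shift mult.assoc[of "c - 1"])
  also have "z powr (\<nu> - 1) * suminf \<dots> = (c - 1) * gen_bessel b c (\<nu> - 1) \<rho> z"
    unfolding gen_bessel_eq_power_series[OF \<rho> z0]
    by (subst suminf_mult[OF bessel_coeff_entire[OF \<rho>]]) simp
  finally have "((\<lambda>w. w powr \<nu> * (\<Sum>k. a' k * (w\<^sup>2) ^ k)) has_field_derivative
          (c - 1) * gen_bessel b c (\<nu> - 1) \<rho> z) (at z)" .
  then have "((\<lambda>w. w powr (- \<nu> + 1) * deriv ?H w)
         has_field_derivative (c - 1) * gen_bessel b c (\<nu> - 1) \<rho> z) (at z)"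
    by (rule has_field_derivative_transform_within_open[OF _ op z]) (simp only: middle)
  moreover have "?H field_differentiable (at z)"
    using dH[OF z] by (auto simp: field_differentiable_def)
  ultimately show ?thesis by blast
qed

end
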